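(* Let $D$ be a connected mixed graph all of whose real mixed cycles are positive mixed cycles of even length. Then $\rho(D)>\rho(D-u)$ and $\rho(D)>\rho(D-e)$ for every vertex $u$ and every edge $e$ of $D$.
   Context: A mixed graph $D$ is obtained from a simple undirected graph $G(D)$ by orienting some subset of its edges; $D$ is connected if $G(D)$ is. Its Hermitian adjacency matrix $H(D)=[h_{uv}]$ has $h_{uv}=1$ for an undirected edge $\{u,v\}$, $h_{uv}=\mathrm{i}$ for a directed edge $(u,v)$, $h_{uv}=-\mathrm{i}$ for a directed edge $(v,u)$, and $0$ otherwise. $\rho(D)$ is the maximum absolute value of an eigenvalue of $H(D)$. A mixed cycle is a cycle of $G(D)$ with the orientations from $D$; its value $h(C)=h_{v_1v_2}\cdots h_{v_kv_1}$ for $C=v_1\cdots v_kv_1$. $C$ is real if $h(C)=\pm1$, positive if $h(C)=1$. $D-u$ deletes the vertex $u$, $D-e$ deletes the edge $e$. *)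

theory Defs
  imports "Jordan_Normal_Form.Spectral_Radius"
begin

text \<open>
  A mixed graph is stored as its underlying simple graph together with the chosen orientations:
  an edge \<open>{u, v}\<close> counts as directed from \<open>u\<close> to \<open>v\<close> if \<open>(u, v)\<close> is an arc, and as
  undirected if neither \<open>(u, v)\<close> nor \<open>(v, u)\<close> is.
\<close>

record 'a mixed_graph =
  verts :: "'a set"
  edges :: "'a set set"
  arcs :: "('a \<times> 'a) set"

definition is_mixed_graph :: "'a mixed_graph \<Rightarrow> bool" where
  "is_mixed_graph D \<longleftrightarrow>
     finite (verts D) \<and>
     (\<forall>e\<in>edges D. e \<subseteq> verts D \<and> card e = 2) \<and>
     (\<forall>(u, v)\<in>arcs D. {u, v} \<in> edges D \<and> (v, u) \<notin> arcs D)"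

definition connected_mixed_graph :: "'a mixed_graph \<Rightarrow> bool" where
  "connected_mixed_graph D \<longleftrightarrow>
     verts D \<noteq> {} \<and>
     (\<forall>u\<in>verts D. \<forall>v\<in>verts D. (u, v) \<in> {(x, y). {x, y} \<in> edges D}\<^sup>*)"

definition delete_vertex :: "'a mixed_graph \<Rightarrow> 'a \<Rightarrow> 'a mixed_graph" where
  "delete_vertex D u =
     \<lparr>verts = verts D - {u},
      edges = {e \<in> edges D. u \<notin> e},
      arcs = {(x, y) \<in> arcs D. x \<noteq> u \<and> y \<noteq> u}\<rparr>"

definition delete_edge :: "'a mixed_graph \<Rightarrow> 'a set \<Rightarrow> 'a mixed_graph" where
  "delete_edge D e =
     \<lparr>verts = verts D,
      edges = edges D - {e},
      arcs = {(x, y) \<in> arcs D. {x, y} \<noteq> e}\<rparr>"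

definition hermitian_entry :: "'a mixed_graph \<Rightarrow> 'a \<Rightarrow> 'a \<Rightarrow> complex" where
  "hermitian_entry D u v =
     (if {u, v} \<notin> edges D then 0
      else if (u, v) \<in> arcs D then \<i>
      else if (v, u) \<in> arcs D then - \<i>
      else 1)"

definition hermitian_adjacency_list :: "'a mixed_graph \<Rightarrow> 'a list \<Rightarrow> complex mat" where
  "hermitian_adjacency_list D vs =
     mat (length vs) (length vs) (\<lambda>(i, j). hermitian_entry D (vs ! i) (vs ! j))"

text \<open>
  Library matrices are indexed by natural numbers, so the vertices have to be enumerated. The
  enumeration is an arbitrary fixed one; by \<open>mixed_spectral_radius_eq\<close> below the spectral radius
  does not depend on it.
\<close>

definition hermitian_adjacency :: "'a mixed_graph \<Rightarrow> complex mat" where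
  "hermitian_adjacency D =
     hermitian_adjacency_list D (SOME vs. distinct vs \<and> set vs = verts D)"

definition mixed_spectral_radius :: "'a mixed_graph \<Rightarrow> real" where
  "mixed_spectral_radius D = spectral_radius (hermitian_adjacency D)"

text \<open>A list \<open>[v\<^sub>1, \<dots>, v\<^sub>k]\<close> represents the closed walk \<open>v\<^sub>1 \<dots> v\<^sub>k v\<^sub>1\<close>.\<close>

definition mixed_cycle :: "'a mixed_graph \<Rightarrow> 'a list \<Rightarrow> bool" where
  "mixed_cycle D vs \<longleftrightarrow>
     length vs \<ge> 3 \<and> distinct vs \<and>
     (\<forall>i<length vs. {vs ! i, vs ! (Suc i mod length vs)} \<in> edges D)"

definition cycle_value :: "'a mixed_graph \<Rightarrow> 'a list \<Rightarrow> complex" where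
  "cycle_value D vs =
     (\<Prod>i<length vs. hermitian_entry D (vs ! i) (vs ! (Suc i mod length vs)))"

definition real_cycle :: "'a mixed_graph \<Rightarrow> 'a list \<Rightarrow> bool" where
  "real_cycle D vs \<longleftrightarrow> mixed_cycle D vs \<and> (cycle_value D vs = 1 \<or> cycle_value D vs = - 1)"

definition positive_cycle :: "'a mixed_graph \<Rightarrow> 'a list \<Rightarrow> bool" where
  "positive_cycle D vs \<longleftrightarrow> mixed_cycle D vs \<and> cycle_value D vs = 1"

lemma is_mixed_graph_delete_vertex:
  "is_mixed_graph D \<Longrightarrow> is_mixed_graph (delete_vertex D u)"
  by (fastforce simp: is_mixed_graph_def delete_vertex_def)

lemma is_mixed_graph_delete_edge:
  "is_mixed_graph D \<Longrightarrow> is_mixed_graph (delete_edge D e)"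
  by (fastforce simp: is_mixed_graph_def delete_edge_def)

lemma eigenvalue_hermitian_adjacency_list:
  assumes "distinct vs"
  shows "eigenvalue (hermitian_adjacency_list D vs) k \<longleftrightarrow>
    (\<exists>x. (\<exists>v\<in>set vs. x v \<noteq> 0) \<and>
         (\<forall>u\<in>set vs. (\<Sum>v\<in>set vs. hermitian_entry D u v * x v) = k * x u))"
    (is "?L \<longleftrightarrow> ?R")
proof -
  let ?n = "length vs" and ?A = "hermitian_adjacency_list D vs"
  have bij: "bij_betw ((!) vs) {..<?n} (set vs)"
    using assms by (simp add: bij_betw_nth)
  have row: "(?A *\<^sub>v vec ?n (\<lambda>i. x (vs ! i))) $ i =
      (\<Sum>v\<in>set vs. hermitian_entry D (vs ! i) v * x v)" if "i < ?n" for x i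
  proof -
    have "(?A *\<^sub>v vec ?n (\<lambda>i. x (vs ! i))) $ i =
        (\<Sum>j<?n. hermitian_entry D (vs ! i) (vs ! j) * x (vs ! j))"
      using that by (simp add: hermitian_adjacency_list_def scalar_prod_def lessThan_atLeast0)
    also have "\<dots> = (\<Sum>v\<in>set vs. hermitian_entry D (vs ! i) v * x v)"
      by (rule sum.reindex_bij_betw[OF bij])
    finally show ?thesis .
  qed
  have dim: "dim_row ?A = ?n" by (simp add: hermitian_adjacency_list_def)
  have ev: "eigenvector ?A (vec ?n (\<lambda>i. x (vs ! i))) k \<longleftrightarrow>
      (\<exists>v\<in>set vs. x v \<noteq> 0) \<and>
      (\<forall>u\<in>set vs. (\<Sum>v\<in>set vs. hermitian_entry D u v * x v) = k * x u)" for x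
  proof -
    have "vec ?n (\<lambda>i. x (vs ! i)) \<noteq> 0\<^sub>v ?n \<longleftrightarrow> (\<exists>v\<in>set vs. x v \<noteq> 0)"
      by (auto simp: vec_eq_iff Bex_def in_set_conv_nth)
    moreover have "?A *\<^sub>v vec ?n (\<lambda>i. x (vs ! i)) = k \<cdot>\<^sub>v vec ?n (\<lambda>i. x (vs ! i)) \<longleftrightarrow>
        (\<forall>i<?n. (?A *\<^sub>v vec ?n (\<lambda>i. x (vs ! i))) $ i = k * x (vs ! i))"
      using dim by (auto simp: vec_eq_iff simp del: index_mult_mat_vec)
    moreover have "\<dots> \<longleftrightarrow>
        (\<forall>u\<in>set vs. (\<Sum>v\<in>set vs. hermitian_entry D u v * x v) = k * x u)"
      by (simp add: row all_set_conv_all_nth del: index_mult_mat_vec)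
    ultimately show ?thesis by (simp add: eigenvector_def dim)
  qed
  show ?thesis
  proof
    assume ?L
    then obtain w where w: "eigenvector ?A w k" by (auto simp: eigenvalue_def)
    define x where "x = (\<lambda>v. w $ (inv_into {..<?n} ((!) vs) v))"
    have "w = vec ?n (\<lambda>i. x (vs ! i))"
      using w bij by (auto simp: eigenvector_def dim x_def vec_eq_iff bij_betw_def inv_into_f_f)
    with w ev show ?R by metis
  next
    assume ?R
    with ev show ?L unfolding eigenvalue_def by metis
  qed
qed

lemma mixed_spectral_radius_eq:
  assumes "distinct vs" "set vs = verts D"
  shows "mixed_spectral_radius D = spectral_radius (hermitian_adjacency_list D vs)"
proof -
  let ?ws = "SOME ws. distinct ws \<and> set ws = verts D"
  have "distinct ?ws \<and> set ?ws = verts D"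
    by (rule someI[of _ vs]) (use assms in simp)
  then have "eigenvalue (hermitian_adjacency D) = eigenvalue (hermitian_adjacency_list D vs)"
    using assms unfolding hermitian_adjacency_def
    by (intro ext) (simp add: eigenvalue_hermitian_adjacency_list)
  then show ?thesis
    by (simp add: mixed_spectral_radius_def spectral_radius_def spectrum_def)
qed

end

theory Submission
  imports Defs "HOL-Analysis.Elementary_Metric_Spaces"
begin

text \<open>
  Let \<open>p T\<close> be the characteristic polynomial of the principal submatrix of the Hermitian adjacency
  matrix \<open>h\<close> on \<open>T\<close>. Sorting permutations by their cycle through a vertex \<open>u \<notin> S\<close> and taking real
  parts gives \<open>p (S \<union> {u}) = x p S - \<Sum>\<^sub>Z Re (h Z) p (S - Z)\<close>, where \<open>Z\<close> runs over the cyclic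
  sequences through \<open>u\<close>, edges included. The hypothesis on cycles makes all
  \<open>Re (h Z)\<close> nonnegative, for \<open>h\<close> and for \<open>- h\<close>, since non-real cycles have value \<open>\<plusminus>\<i>\<close>.

  Let \<open>x\<^sub>0\<close> be the largest zero of all the \<open>p T\<close> with \<open>T \<subseteq> V\<close>, and let \<open>C\<close> be minimal with
  \<open>p C x\<^sub>0 = 0\<close>. If \<open>C \<noteq> V\<close>, some \<open>u \<notin> C\<close> has a neighbour in \<open>C\<close>, and the expansion yields
  \<open>p (C \<union> {u}) x\<^sub>0 < 0\<close>, which is impossible. So \<open>x\<^sub>0\<close> is a zero of \<open>p V\<close> and of no \<open>p T\<close> with \<open>T \<subset> V\<close>.
  Removing an edge \<open>{a, b}\<close> only drops terms of the expansion at \<open>a\<close>, among them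
  \<open>p (V - {a, b}) > 0\<close>, so the new \<open>p V\<close> is positive on \<open>[x\<^sub>0, \<infinity>)\<close>.
  The same for \<open>- h\<close> deals with the negative eigenvalues.
\<close>

section \<open>Determinants over finite index sets\<close>

text \<open>The Leibniz determinant over an arbitrary index set: principal submatrices arise by
  changing \<open>S\<close> alone, and induction over vertex sets needs no enumeration.\<close>

definition sdet :: "'b set \<Rightarrow> ('b \<Rightarrow> 'b \<Rightarrow> 'c::comm_ring_1) \<Rightarrow> 'c" where
  "sdet S M = (\<Sum>p | p permutes S. of_int (sign p) * (\<Prod>i\<in>S. M i (p i)))"

lemma sdet_empty [simp]: "sdet {} M = 1"
  by (simp add: sdet_def)

lemma sdet_cong:
  assumes "\<And>i j. i \<in> S \<Longrightarrow> j \<in> S \<Longrightarrow> M i j = N i j"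
  shows "sdet S M = sdet S N"
  unfolding sdet_def using assms
  by (intro sum.cong refl arg_cong2[where f = "(*)"] prod.cong) (auto simp: permutes_in_image)

lemma sdet_scale: "sdet S (\<lambda>i j. c * M i j) = c ^ card S * sdet S M"
  by (simp add: sdet_def prod.distrib sum_distrib_left algebra_simps)

lemma sdet_transpose:
  assumes "finite S"
  shows "sdet S (\<lambda>i j. M j i) = sdet S M"
proof -
  have "sdet S M = (\<Sum>p | p permutes S. of_int (sign (Hilbert_Choice.inv p)) *
      (\<Prod>i\<in>S. M i (Hilbert_Choice.inv p i)))"
    unfolding sdet_def by (rule sum_permutations_inverse)
  also have "\<dots> = (\<Sum>p | p permutes S. of_int (sign p) * (\<Prod>i\<in>S. M (p i) i))"
  proof (intro sum.cong refl arg_cong2[where f = "(*)"])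
    fix p assume "p \<in> {p. p permutes S}"
    then have p: "p permutes S" by simp
    show "of_int (sign (Hilbert_Choice.inv p)) = (of_int (sign p) :: 'b)"
      using p assms permutation_permutes by (metis sign_inverse)
    have "(\<Prod>i\<in>S. M i (Hilbert_Choice.inv p i)) = prod ((\<lambda>i. M i (Hilbert_Choice.inv p i)) \<circ> p) S"
      by (rule prod.permute[OF p])
    then show "(\<Prod>i\<in>S. M i (Hilbert_Choice.inv p i)) = (\<Prod>i\<in>S. M (p i) i)"
      by (simp add: permutes_inverses(2)[OF p])
  qed
  finally show ?thesis by (simp add: sdet_def)
qed

text \<open>A permutation of \<open>insert u S\<close> factors uniquely as the transposition of
  \<open>u\<close> and its image \<open>b\<close>, applied after a permutation of \<open>S\<close>.
  The case \<open>b = u\<close> gives the diagonal term; any other \<open>b\<close> contributes sign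
  -1 and replaces column \<open>b\<close> by column \<open>u\<close>.\<close>

lemma sdet_insert:
  assumes "finite S" "u \<notin> S"
  shows "sdet (insert u S) M =
    M u u * sdet S M - (\<Sum>v\<in>S. M u v * sdet S (\<lambda>i j. M i (if j = v then u else j)))"
proof -
  have swap: "(\<Sum>q | q permutes S. of_int (sign (Transposition.transpose u b \<circ> q)) *
        (\<Prod>i\<in>insert u S. M i ((Transposition.transpose u b \<circ> q) i))) =
      of_int (sign (Transposition.transpose u b)) * M u b *
        sdet S (\<lambda>i j. M i (Transposition.transpose u b j))" for b
    unfolding sdet_def sum_distrib_left
  proof (intro sum.cong refl)
    fix q assume "q \<in> {q. q permutes S}"
    then have q: "q permutes S" by simp
    then have "q u = u" using assms by (simp add: permutes_def)
    moreover have "permutation q" using q assms permutation_permutes by blast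
    ultimately show "of_int (sign (Transposition.transpose u b \<circ> q)) *
        (\<Prod>i\<in>insert u S. M i ((Transposition.transpose u b \<circ> q) i)) =
      of_int (sign (Transposition.transpose u b)) * M u b *
        (of_int (sign q) * (\<Prod>i\<in>S. M i (Transposition.transpose u b (q i))))"
      using assms by (simp add: sign_compose permutation_swap_id algebra_simps)
  qed
  have "sdet (insert u S) M = (\<Sum>b\<in>insert u S. of_int (sign (Transposition.transpose u b)) *
      M u b * sdet S (\<lambda>i j. M i (Transposition.transpose u b j)))"
    unfolding sdet_def[of "insert u S"]
    by (subst sum_over_permutations_insert[OF assms]) (simp only: swap)
  also have "\<dots> = M u u * sdet S M -
      (\<Sum>v\<in>S. M u v * sdet S (\<lambda>i j. M i (Transposition.transpose u v j)))"
  proof -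
    have "(\<Sum>b\<in>S. of_int (sign (Transposition.transpose u b)) *
        M u b * sdet S (\<lambda>i j. M i (Transposition.transpose u b j))) =
      (\<Sum>b\<in>S. - (M u b * sdet S (\<lambda>i j. M i (Transposition.transpose u b j))))"
      using assms by (intro sum.cong refl) (auto simp: sign_swap_id)
    then show ?thesis using assms by (simp add: sum_negf)
  qed
  also have "(\<Sum>v\<in>S. M u v * sdet S (\<lambda>i j. M i (Transposition.transpose u v j))) =
      (\<Sum>v\<in>S. M u v * sdet S (\<lambda>i j. M i (if j = v then u else j)))"
    using assms
    by (intro sum.cong refl arg_cong2[where f = "(*)"] sdet_cong)
      (auto simp: Transposition.transpose_def)
  finally show ?thesis .
qed

text \<open>Induction through \<open>sdet_insert\<close> on both sides; this carries
  \<open>sdet\<close> over to index sets \<open>{0..<n}\<close>, where it is the matrix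
  determinant.\<close>

lemma sdet_image:
  assumes "finite S" "inj_on f S"
  shows "sdet (f ` S) M = sdet S (\<lambda>i j. M (f i) (f j))"
  using assms
proof (induction S arbitrary: M rule: finite_induct)
  case (insert u S)
  have inj: "inj_on f S" and u: "f u \<notin> f ` S" using insert by auto
  have "sdet (f ` insert u S) M = M (f u) (f u) * sdet (f ` S) M -
      (\<Sum>v\<in>f ` S. M (f u) v * sdet (f ` S) (\<lambda>i j. M i (if j = v then f u else j)))"
    using insert u by (simp add: sdet_insert)
  also have "\<dots> = M (f u) (f u) * sdet S (\<lambda>i j. M (f i) (f j)) -
      (\<Sum>v\<in>S. M (f u) (f v) * sdet S (\<lambda>i j. M (f i) (if f j = f v then f u else f j)))"
    by (simp add: sum.reindex[OF inj] insert.IH[OF inj])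
  also have "(\<Sum>v\<in>S. M (f u) (f v) * sdet S (\<lambda>i j. M (f i) (if f j = f v then f u else f j))) =
      (\<Sum>v\<in>S. M (f u) (f v) * sdet S (\<lambda>i j. M (f i) (f (if j = v then u else j))))"
    using inj
    by (intro sum.cong refl arg_cong2[where f = "(*)"] sdet_cong) (auto simp: inj_on_def)
  finally show ?case
    using insert(1,2) by (simp add: sdet_insert)
qed simp

text \<open>An enumeration of \<open>S\<close> turns \<open>sdet\<close> into \<open>det\<close>,
  which vanishes exactly when the kernel is nontrivial.\<close>

lemma sdet_eq_0_iff:
  fixes M :: "'b \<Rightarrow> 'b \<Rightarrow> 'c::field"
  assumes "finite S"
  shows "sdet S M = 0 \<longleftrightarrow>
    (\<exists>x. (\<exists>v\<in>S. x v \<noteq> 0) \<and> (\<forall>u\<in>S. (\<Sum>v\<in>S. M u v * x v) = 0))" (is "_ \<longleftrightarrow> ?R")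
proof -
  obtain vs where vs: "distinct vs" "set vs = S"
    using finite_distinct_list[OF assms] by blast
  let ?n = "length vs"
  define A where "A = mat ?n ?n (\<lambda>(i, j). M (vs ! i) (vs ! j))"
  have A: "A \<in> carrier_mat ?n ?n" by (simp add: A_def)
  have bij: "bij_betw ((!) vs) {0..<?n} S"
    using vs by (simp add: bij_betw_nth lessThan_atLeast0)
  have "sdet S M = sdet {0..<?n} (\<lambda>i j. M (vs ! i) (vs ! j))"
    using sdet_image[of "{0..<?n}" "(!) vs" M] bij by (simp add: bij_betw_def)
  also have "\<dots> = det A"
    unfolding sdet_def det_def'[OF A]
    by (intro sum.cong refl arg_cong2[where f = "(*)"] prod.cong)
      (auto simp: A_def permutes_in_image)
  finally have det: "sdet S M = det A" .
  have row: "(A *\<^sub>v vec ?n (\<lambda>i. x (vs ! i))) $ i = (\<Sum>v\<in>S. M (vs ! i) v * x v)"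
    if "i < ?n" for x i
    using that sum.reindex_bij_betw[OF bij, of "\<lambda>v. M (vs ! i) v * x v"]
    by (simp add: A_def scalar_prod_def)
  have ker: "vec ?n (\<lambda>i. x (vs ! i)) \<noteq> 0\<^sub>v ?n \<and> A *\<^sub>v vec ?n (\<lambda>i. x (vs ! i)) = 0\<^sub>v ?n \<longleftrightarrow>
      (\<exists>v\<in>S. x v \<noteq> 0) \<and> (\<forall>u\<in>S. (\<Sum>v\<in>S. M u v * x v) = 0)" for x
  proof -
    have "vec ?n (\<lambda>i. x (vs ! i)) \<noteq> 0\<^sub>v ?n \<longleftrightarrow> (\<exists>v\<in>S. x v \<noteq> 0)"
      unfolding vs(2)[symmetric] by (auto simp: vec_eq_iff Bex_def in_set_conv_nth)
    moreover have "A *\<^sub>v vec ?n (\<lambda>i. x (vs ! i)) = 0\<^sub>v ?n \<longleftrightarrow>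
        (\<forall>i<?n. (A *\<^sub>v vec ?n (\<lambda>i. x (vs ! i))) $ i = 0)"
      using A by (auto simp: vec_eq_iff simp del: index_mult_mat_vec)
    moreover have "\<dots> \<longleftrightarrow> (\<forall>u\<in>S. (\<Sum>v\<in>S. M u v * x v) = 0)"
      by (simp add: row vs(2)[symmetric] all_set_conv_all_nth del: index_mult_mat_vec)
    ultimately show ?thesis by simp
  qed
  show ?thesis
  proof
    assume "sdet S M = 0"
    then obtain w where w: "w \<in> carrier_vec ?n" "w \<noteq> 0\<^sub>v ?n" "A *\<^sub>v w = 0\<^sub>v ?n"
      using det_0_iff_vec_prod_zero[OF A] det by auto
    define x where "x = (\<lambda>v. w $ (inv_into {0..<?n} ((!) vs) v))"
    have "w = vec ?n (\<lambda>i. x (vs ! i))"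
      using w(1) bij by (auto simp: x_def vec_eq_iff bij_betw_def inv_into_f_f)
    with w ker show ?R by metis
  next
    assume ?R
    then obtain x where "vec ?n (\<lambda>i. x (vs ! i)) \<noteq> 0\<^sub>v ?n"
      "A *\<^sub>v vec ?n (\<lambda>i. x (vs ! i)) = 0\<^sub>v ?n"
      using ker by blast
    then show "sdet S M = 0"
      unfolding det det_0_iff_vec_prod_zero[OF A] by (intro exI[of _ "vec ?n (\<lambda>i. x (vs ! i))"]) simp
  qed
qed

section \<open>Expansion along cycles\<close>

definition charmat :: "('b \<Rightarrow> 'b \<Rightarrow> complex) \<Rightarrow> complex \<Rightarrow> 'b \<Rightarrow> 'b \<Rightarrow> complex" where
  "charmat h x i j = (if i = j then x else 0) - h i j"

text \<open>A closed walk is recorded with its first vertex repeated at the end, so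
  \<open>xs @ [hd xs]\<close> has one factor per element of \<open>xs\<close>.\<close>

definition walk_weight :: "('b \<Rightarrow> 'b \<Rightarrow> complex) \<Rightarrow> 'b list \<Rightarrow> complex" where
  "walk_weight h xs = (\<Prod>i<length xs - 1. h (xs ! i) (xs ! Suc i))"

lemma walk_weight_Cons_Cons [simp]:
  "walk_weight h (x # y # zs) = h x y * walk_weight h (y # zs)"
  by (simp add: walk_weight_def prod.lessThan_Suc_shift del: prod.lessThan_Suc)

lemma walk_weight_single [simp]: "walk_weight h [x] = 1"
  by (simp add: walk_weight_def)

text \<open>These lists serve as interiors of paths; \<open>[]\<close> stands for a direct step
  between the endpoints.\<close>

definition dlists :: "'b set \<Rightarrow> 'b list set" where
  "dlists S = {xs. distinct xs \<and> set xs \<subseteq> S}"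

lemma finite_dlists: "finite S \<Longrightarrow> finite (dlists S)"
  unfolding dlists_def by (rule finite_subset[OF _ finite_subset_distinct]) auto

lemma dlists_empty [simp]: "dlists {} = {[]}"
  by (auto simp: dlists_def)

lemma dlists_minus_Nil: "dlists S - {[]} = (\<Union>v\<in>S. (#) v ` dlists (S - {v}))"
proof (intro equalityI subsetI)
  fix xs assume "xs \<in> dlists S - {[]}"
  then obtain v ys where "xs = v # ys" "v \<in> S" "ys \<in> dlists (S - {v})"
    by (cases xs) (auto simp: dlists_def)
  then show "xs \<in> (\<Union>v\<in>S. (#) v ` dlists (S - {v}))" by blast
qed (auto simp: dlists_def)

lemma sum_dlists_minus_Nil:
  assumes "finite S"
  shows "sum f (dlists S - {[]}) = (\<Sum>v\<in>S. \<Sum>ys\<in>dlists (S - {v}). f (v # ys))"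
proof -
  have "sum f (dlists S - {[]}) = (\<Sum>v\<in>S. sum f ((#) v ` dlists (S - {v})))"
    unfolding dlists_minus_Nil using assms by (intro sum.UNION_disjoint) (auto simp: finite_dlists)
  also have "\<dots> = (\<Sum>v\<in>S. \<Sum>ys\<in>dlists (S - {v}). f (v # ys))"
    by (simp add: sum.reindex)
  finally show ?thesis .
qed

text \<open>Column \<open>v\<close> is overwritten by column \<open>u\<close>, so following a
  permutation from \<open>v\<close> traces a path that ends at \<open>u\<close>; the remaining
  indices form a principal minor. Expanding at \<open>v\<close> either ends the path or moves to
  some \<open>w\<close>, which takes over the role of \<open>v\<close>; hence the induction with
  \<open>v\<close> arbitrary.\<close>

lemma sdet_charmat_redirected:
  assumes "finite T" "v \<notin> T" "u \<notin> insert v T"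
  shows "sdet (insert v T) (\<lambda>i j. charmat h x i (if j = v then u else j)) =
    - (\<Sum>ys\<in>dlists T. walk_weight h (v # ys @ [u]) * sdet (T - set ys) (charmat h x))"
  using assms
proof (induction "card T" arbitrary: T v)
  case 0
  then show ?case by (auto simp: sdet_insert charmat_def)
next
  case (Suc n)
  let ?w = "\<lambda>ys. walk_weight h (v # ys @ [u]) * sdet (T - set ys) (charmat h x)"
  have IH: "sdet T (\<lambda>i j. charmat h x i (if j = w then u else j)) =
      - (\<Sum>ys\<in>dlists (T - {w}). walk_weight h (w # ys @ [u]) *
          sdet (T - {w} - set ys) (charmat h x))" if "w \<in> T" for w
    using Suc.hyps(1)[of "T - {w}" w] Suc.hyps(2) Suc.prems that by (auto simp: insert_absorb)
  have "sdet (insert v T) (\<lambda>i j. charmat h x i (if j = v then u else j)) =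
      charmat h x v u * sdet T (\<lambda>i j. charmat h x i (if j = v then u else j)) -
      (\<Sum>w\<in>T. charmat h x v (if w = v then u else w) *
        sdet T (\<lambda>i j. charmat h x i (if (if j = w then v else j) = v then u
           else (if j = w then v else j))))"
    using Suc.prems by (simp add: sdet_insert)
  also have "sdet T (\<lambda>i j. charmat h x i (if j = v then u else j)) = sdet T (charmat h x)"
    using Suc.prems by (intro sdet_cong) auto
  also have "charmat h x v u = - h v u"
    using Suc.prems by (auto simp: charmat_def)
  \<comment> \<open>Two redirections collapse: column \<open>w\<close> goes to \<open>v\<close> and
    then to \<open>u\<close>, while column \<open>v\<close> is absent from \<open>T\<close>. The
    entries of row \<open>v\<close> involved are off the diagonal.\<close>
  also have "(\<Sum>w\<in>T. charmat h x v (if w = v then u else w) *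
        sdet T (\<lambda>i j. charmat h x i (if (if j = w then v else j) = v then u
           else (if j = w then v else j)))) =
      (\<Sum>w\<in>T. - h v w * sdet T (\<lambda>i j. charmat h x i (if j = w then u else j)))"
    using Suc.prems
    by (intro sum.cong refl arg_cong2[where f = "(*)"] sdet_cong) (auto simp: charmat_def)
  also have "\<dots> = (\<Sum>w\<in>T. \<Sum>ys\<in>dlists (T - {w}). ?w (w # ys))"
  proof (intro sum.cong refl)
    fix w assume "w \<in> T"
    have *: "T - {w} - set ys = T - insert w (set ys)" for ys by auto
    show "- h v w * sdet T (\<lambda>i j. charmat h x i (if j = w then u else j)) =
        (\<Sum>ys\<in>dlists (T - {w}). ?w (w # ys))"
      unfolding IH[OF \<open>w \<in> T\<close>] by (simp add: sum_distrib_left sum_negf algebra_simps *)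
  qed
  also have "\<dots> = sum ?w (dlists T - {[]})"
    using Suc.prems by (simp only: sum_dlists_minus_Nil)
  finally have "sdet (insert v T) (\<lambda>i j. charmat h x i (if j = v then u else j)) =
      - (?w [] + sum ?w (dlists T - {[]}))"
    by simp
  also have "?w [] + sum ?w (dlists T - {[]}) = sum ?w (dlists T)"
    using Suc.prems by (intro sum.remove[symmetric]) (auto simp: finite_dlists, simp add: dlists_def)
  finally show ?case .
qed

text \<open>The first vertex \<open>v\<close> after \<open>u\<close> leaves a redirected matrix on
  \<open>S\<close>, whose paths back to \<open>u\<close> close up to cycles. A singleton
  \<open>xs\<close> is an edge traversed both ways.\<close>

lemma sdet_charmat_insert:
  assumes "finite S" "u \<notin> S"
  shows "sdet (insert u S) (charmat h x) = (x - h u u) * sdet S (charmat h x) -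
    (\<Sum>xs\<in>dlists S - {[]}. walk_weight h (u # xs @ [u]) * sdet (S - set xs) (charmat h x))"
proof -
  have "sdet (insert u S) (charmat h x) = charmat h x u u * sdet S (charmat h x) -
      (\<Sum>v\<in>S. charmat h x u v * sdet S (\<lambda>i j. charmat h x i (if j = v then u else j)))"
    by (rule sdet_insert[OF assms])
  also have "(\<Sum>v\<in>S. charmat h x u v * sdet S (\<lambda>i j. charmat h x i (if j = v then u else j))) =
      (\<Sum>v\<in>S. \<Sum>ys\<in>dlists (S - {v}). walk_weight h (u # (v # ys) @ [u]) *
         sdet (S - set (v # ys)) (charmat h x))"
  proof (intro sum.cong refl)
    fix v assume v: "v \<in> S"
    have *: "S - {v} - set ys = S - insert v (set ys)" for ys by auto
    have "sdet S (\<lambda>i j. charmat h x i (if j = v then u else j)) =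
        - (\<Sum>ys\<in>dlists (S - {v}). walk_weight h (v # ys @ [u]) *
            sdet (S - {v} - set ys) (charmat h x))"
      using sdet_charmat_redirected[of "S - {v}" v u h x] v assms by (auto simp: insert_absorb)
    moreover have "charmat h x u v = - h u v" using v assms by (auto simp: charmat_def)
    ultimately show "charmat h x u v * sdet S (\<lambda>i j. charmat h x i (if j = v then u else j)) =
        (\<Sum>ys\<in>dlists (S - {v}). walk_weight h (u # (v # ys) @ [u]) *
         sdet (S - set (v # ys)) (charmat h x))"
      by (simp add: sum_distrib_left sum_negf algebra_simps *)
  qed
  also have "\<dots> = (\<Sum>xs\<in>dlists S - {[]}. walk_weight h (u # xs @ [u]) *
      sdet (S - set xs) (charmat h x))"
    using assms by (simp only: sum_dlists_minus_Nil)
  also have "charmat h x u u = x - h u u" by (simp add: charmat_def)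
  finally show ?thesis .
qed

section \<open>Real characteristic polynomials of Hermitian matrices\<close>

lemma sdet_charmat_real:
  assumes "finite S" "\<And>i j. h j i = cnj (h i j)"
  shows "sdet S (charmat h (of_real x)) = of_real (Re (sdet S (charmat h (of_real x))))"
proof -
  \<comment> \<open>At a real argument, conjugation transposes the matrix.\<close>
  have "cnj (sdet S (charmat h (of_real x))) = sdet S (\<lambda>i j. charmat h (of_real x) j i)"
    unfolding sdet_def
    by (simp, intro sum.cong refl arg_cong2[where f = "(*)"] prod.cong)
      (auto simp: charmat_def assms(2)[symmetric])
  also have "\<dots> = sdet S (charmat h (of_real x))"
    by (rule sdet_transpose[OF assms(1)])
  finally show ?thesis
    by (metis Reals_cnj_iff of_real_Re)
qed

text \<open>For Hermitian \<open>h\<close> the real part loses nothing, by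
  \<open>sdet_charmat_real\<close>; real values allow sign arguments and the intermediate value
  theorem.\<close>

definition rcharpoly :: "('b \<Rightarrow> 'b \<Rightarrow> complex) \<Rightarrow> 'b set \<Rightarrow> real \<Rightarrow> real" where
  "rcharpoly h S x = Re (sdet S (charmat h (of_real x)))"

lemma rcharpoly_insert:
  assumes "finite S" "u \<notin> S" "\<And>i j. h j i = cnj (h i j)" "h u u = 0"
  shows "rcharpoly h (insert u S) x = x * rcharpoly h S x -
    (\<Sum>xs\<in>dlists S - {[]}. Re (walk_weight h (u # xs @ [u])) * rcharpoly h (S - set xs) x)"
proof -
  \<comment> \<open>The smaller determinants are real, so only the real part of the walk weight
    survives.\<close>
  have *: "Re (z * sdet T (charmat h (of_real x))) = Re z * rcharpoly h T x" if "finite T" for z T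
    unfolding rcharpoly_def by (subst sdet_charmat_real[OF that assms(3)]) simp
  show ?thesis
    using assms(1,4) unfolding rcharpoly_def[of h "insert u S"] sdet_charmat_insert[OF assms(1,2)]
    by (simp add: * del: times_complex.sel)
qed

lemma continuous_rcharpoly: "continuous_on A (rcharpoly h S)"
proof -
  have "continuous_on A (\<lambda>x. charmat h (of_real x) i j)" for i j
    by (cases "i = j") (auto simp: charmat_def intro!: continuous_intros)
  then show ?thesis
    unfolding rcharpoly_def sdet_def by (intro continuous_intros)
qed

lemma sdet_identity:
  assumes "finite S"
  shows "sdet S (\<lambda>i j. if i = j then 1 else 0) = 1"
  using assms by (induction S rule: finite_induct) (auto simp: sdet_insert intro!: sum.neutral)

lemma rcharpoly_eventually_pos:
  assumes "finite S"
  shows "eventually (\<lambda>x. rcharpoly h S x > 0) at_top"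
proof -
  \<comment> \<open>\<open>g\<close> is the characteristic polynomial divided by
    \<open>x ^ card S\<close>, in the variable \<open>t = 1/x\<close>; at \<open>t = 0\<close> it is
    the determinant of the identity.\<close>
  define g where "g = (\<lambda>t::real. Re (sdet S (\<lambda>i j. (if i = j then 1 else 0) - of_real t * h i j)))"
  have "continuous_on UNIV g"
    unfolding g_def sdet_def by (intro continuous_intros)
  then have "isCont g 0" by (simp add: continuous_on_eq_continuous_at)
  moreover have "g 0 = 1" by (simp add: g_def sdet_identity[OF assms])
  ultimately have "((\<lambda>x. g (inverse x)) \<longlongrightarrow> 1) at_top"
    using isCont_tendsto_compose tendsto_inverse_0_at_top[OF filterlim_ident] by metis
  then have pos: "eventually (\<lambda>x. g (inverse x) > 0) at_top"
    by (rule order_tendstoD) simp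
  have scale: "rcharpoly h S x = x ^ card S * g (inverse x)" if "x > 0" for x
  proof -
    have "sdet S (charmat h (of_real x)) = of_real x ^ card S *
        sdet S (\<lambda>i j. (if i = j then 1 else 0) - of_real (inverse x) * h i j)"
      unfolding sdet_scale[symmetric] using that
      by (intro sdet_cong) (auto simp: charmat_def field_simps)
    then show ?thesis
      unfolding rcharpoly_def g_def by (simp flip: of_real_power)
  qed
  show ?thesis
    using pos eventually_gt_at_top[of 0] by eventually_elim (simp add: scale)
qed

section \<open>Hermitian matrices with nonnegative cycles\<close>

lemma rcharpoly_empty [simp]: "rcharpoly h {} x = 1"
  by (simp add: rcharpoly_def)

text \<open>\<open>cycle_nonneg\<close> starts at length 3 because an edge walked back and forth has
  the nonnegative weight of \<open>edge_weight\<close>. Connectedness is phrased as an edge leaving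
  each proper nonempty subset.\<close>

locale nonneg_cycle_gain =
  fixes V :: "'b set" and h :: "'b \<Rightarrow> 'b \<Rightarrow> complex"
  assumes finite_V: "finite V" and V_nonempty: "V \<noteq> {}"
    and hermitian: "h j i = cnj (h i j)" and diag: "h i i = 0"
    and cycle_nonneg: "\<lbrakk>distinct xs; set xs \<subseteq> V; length xs \<ge> 3\<rbrakk> \<Longrightarrow>
      Re (walk_weight h (xs @ [hd xs])) \<ge> 0"
    and connected: "\<lbrakk>C \<subset> V; C \<noteq> {}\<rbrakk> \<Longrightarrow> \<exists>u\<in>V - C. \<exists>v\<in>C. h u v \<noteq> 0"
begin

lemma edge_weight: "Re (walk_weight h (u # [v] @ [u])) = (cmod (h u v))\<^sup>2"
  by (simp add: hermitian[of v u] cmod_power2 flip: power2_eq_square)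

lemma walk_nonneg:
  assumes "u \<in> V" "xs \<in> dlists S - {[]}" "S \<subseteq> V - {u}"
  shows "Re (walk_weight h (u # xs @ [u])) \<ge> 0"
proof (cases "length xs = 1")
  case True
  then obtain v where "xs = [v]" by (auto simp: length_Suc_conv)
  then show ?thesis by (metis edge_weight zero_le_power2)
next
  case False
  then have "length xs \<ge> 2" using assms(2) by (cases xs) (auto simp: Suc_le_eq)
  then show ?thesis
    using cycle_nonneg[of "u # xs"] assms by (auto simp: dlists_def)
qed

text \<open>The supremum of the zeros for all \<open>T \<subseteq> V\<close> is attained because the
  set of zeros is closed, bounded above and nonempty.\<close>

lemma largest_zero:
  obtains x0 where "rcharpoly h V x0 = 0" "\<And>x. x \<ge> x0 \<Longrightarrow> rcharpoly h V x \<ge> 0"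
    "\<And>T x. T \<subset> V \<Longrightarrow> x \<ge> x0 \<Longrightarrow> rcharpoly h T x > 0"
proof -
  let ?p = "rcharpoly h"
  define Z where "Z = (\<Union>T\<in>Pow V. {x. ?p T x = 0})"
  have fin: "finite T" if "T \<subseteq> V" for T using that finite_V finite_subset by blast
  have "eventually (\<lambda>x. \<forall>T\<in>Pow V. ?p T x > 0) at_top"
    using finite_V fin by (intro eventually_ball_finite) (auto intro: rcharpoly_eventually_pos)
  then obtain B where B: "?p T x > 0" if "x \<ge> B" "T \<subseteq> V" for x T
    by (auto simp: eventually_at_top_linorder)
  have "closed {x. ?p T x = 0}" for T
    by (intro closed_Collect_eq continuous_rcharpoly continuous_on_const)
  then have closed: "closed Z"
    unfolding Z_def using finite_V by (intro closed_UN) auto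
  have bdd: "bdd_above Z"
  proof (rule bdd_aboveI)
    fix x assume "x \<in> Z"
    then obtain T where "T \<subseteq> V" "?p T x = 0" by (auto simp: Z_def)
    then show "x \<le> B" using B[of x T] by linarith
  qed
  \<comment> \<open>A one-vertex minor has the zero 0, because the diagonal vanishes.\<close>
  obtain v where "v \<in> V" using V_nonempty by blast
  moreover have "?p {v} 0 = 0"
    using rcharpoly_insert[OF _ _ hermitian diag, where S = "{}" and u = v and x = 0] by simp
  ultimately have "Z \<noteq> {}" unfolding Z_def by blast
  define x0 where "x0 = Sup Z"
  have "x0 \<in> Z"
    unfolding x0_def by (rule closed_contains_Sup[OF \<open>Z \<noteq> {}\<close> bdd closed])
  then obtain T0 where T0: "T0 \<subseteq> V" "?p T0 x0 = 0" by (auto simp: Z_def)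
  have upper: "y \<le> x0" if "T \<subseteq> V" "?p T y = 0" for T y
    unfolding x0_def using that by (intro cSup_upper bdd) (auto simp: Z_def)
  \<comment> \<open>Positivity for large arguments and the intermediate value theorem turn a
    nonpositive value at \<open>x\<close> into a zero at \<open>x\<close> or beyond.\<close>
  have zero_above: "\<exists>y\<ge>x. ?p T y = 0" if "T \<subseteq> V" "?p T x \<le> 0" for T x
  proof -
    have "?p T (max x B) \<ge> 0" using B[of "max x B" T] that by simp
    then have "\<exists>y. x \<le> y \<and> y \<le> max x B \<and> ?p T y = 0"
      using that by (intro IVT' continuous_rcharpoly) auto
    then show ?thesis by blast
  qed
  have nonneg: "?p T x \<ge> 0" if Tx: "T \<subseteq> V" "x \<ge> x0" for T x
  proof (rule ccontr)
    assume neg: "\<not> ?p T x \<ge> 0"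
    then obtain y where y: "y \<ge> x" "?p T y = 0" using zero_above[of T x] Tx by auto
    then have "y = x" using upper[of T y] that by auto
    with y neg show False by simp
  qed
  \<comment> \<open>In the expansion at \<open>u\<close> the leading term vanishes because
    \<open>?p C x0 = 0\<close>, no cycle term is negative, and the edge from \<open>u\<close> to
    \<open>v\<close> gives a positive one by minimality of \<open>C\<close>. The resulting negative
    value contradicts \<open>nonneg\<close>.\<close>
  have minimal_is_V: "C = V"
    if C: "C \<subseteq> V" "?p C x0 = 0" and min: "\<And>T. T \<subset> C \<Longrightarrow> ?p T x0 \<noteq> 0" for C
  proof (rule ccontr)
    assume "C \<noteq> V"
    moreover have "C \<noteq> {}" using C by auto
    ultimately obtain u v where uv: "u \<in> V - C" "v \<in> C" "h u v \<noteq> 0"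
      using connected[of C] C by blast
    let ?f = "\<lambda>xs. Re (walk_weight h (u # xs @ [u])) * ?p (C - set xs) x0"
    have "?p (C - {v}) x0 > 0"
      using min[of "C - {v}"] nonneg[of "C - {v}" x0] uv C by fastforce
    then have "0 < ?f [v]"
      using uv edge_weight[of u v] by simp
    also have "?f [v] \<le> sum ?f (dlists C - {[]})"
    proof (rule member_le_sum)
      show "[v] \<in> dlists C - {[]}" using uv by (simp add: dlists_def)
      show "finite (dlists C - {[]})" using fin[OF C(1)] by (simp add: finite_dlists)
      fix xs assume "xs \<in> dlists C - {[]} - {[v]}"
      then show "0 \<le> ?f xs"
        using uv C by (intro mult_nonneg_nonneg walk_nonneg[of u xs C] nonneg) auto
    qed
    finally have "?p (insert u C) x0 < 0"
      using rcharpoly_insert[OF fin[OF C(1)] _ hermitian diag, where u = u and x = x0] uv C by simp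
    then show False using nonneg[of "insert u C" x0] uv C by auto
  qed
  have *: "T = V" if T: "T \<subseteq> V" "?p T x0 = 0" for T
  proof -
    obtain C where "C \<in> {T \<in> Pow V. ?p T x0 = 0}" "C \<subseteq> T"
        "\<forall>b\<in>{T \<in> Pow V. ?p T x0 = 0}. b \<subseteq> C \<longrightarrow> C = b"
      using finite_has_minimal2[of "{T \<in> Pow V. ?p T x0 = 0}" T] T finite_V by auto
    then have "C = V" by (intro minimal_is_V) auto
    with \<open>C \<subseteq> T\<close> T show ?thesis by blast
  qed
  show thesis
  proof
    show "?p V x0 = 0" using * T0 by metis
    show "?p V x \<ge> 0" if "x \<ge> x0" for x using nonneg that by simp
    show "?p T x > 0" if T: "T \<subset> V" "x \<ge> x0" for T x
    proof (rule ccontr)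
      assume "\<not> ?p T x > 0"
      then obtain y where y: "y \<ge> x" "?p T y = 0" using zero_above[of T x] T by auto
      then have "y = x0" using upper[of T y] T by auto
      then show False using * y T by auto
    qed
  qed
qed

lemma rcharpoly_remove_edge_pos:
  fixes a b :: 'b
  defines "h' \<equiv> \<lambda>i j. if {i, j} = {a, b} then 0 else h i j"
  assumes ab: "a \<in> V" "b \<in> V" "h a b \<noteq> 0"
    and V: "rcharpoly h V x \<ge> 0" and sub: "\<And>T. T \<subset> V \<Longrightarrow> rcharpoly h T x > 0"
  shows "rcharpoly h' V x > 0"
proof -
  define S where "S = V - {a}"
  have "a \<noteq> b" using ab diag by auto
  have S: "finite S" "a \<notin> S" "V = insert a S" "b \<in> S"
    using finite_V ab \<open>a \<noteq> b\<close> by (auto simp: S_def)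
  \<comment> \<open>Minors avoiding \<open>a\<close> do not see the deleted entries, so those in the
    expansion at \<open>a\<close> are unchanged.\<close>
  have same: "rcharpoly h' T x = rcharpoly h T x" if "a \<notin> T" for T
    unfolding rcharpoly_def using that
    by (intro arg_cong[where f = Re] sdet_cong) (auto simp: charmat_def h'_def doubleton_eq_iff)
  \<comment> \<open>Zeroing the two entries either misses a walk or makes its product vanish; as
    weights through \<open>a\<close> have nonnegative real part, no term grows.\<close>
  have "walk_weight h' ys = walk_weight h ys \<or> walk_weight h' ys = 0" for ys
  proof (cases "\<exists>i<length ys - 1. {ys ! i, ys ! Suc i} = {a, b}")
    case True
    then show ?thesis unfolding walk_weight_def h'_def by (intro disjI2 prod_zero) auto
  next
    case False
    then show ?thesis unfolding walk_weight_def h'_def by (intro disjI1 prod.cong) auto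
  qed
  then have le: "Re (walk_weight h' (a # xs @ [a])) \<le> Re (walk_weight h (a # xs @ [a]))"
    if "xs \<in> dlists S - {[]}" for xs
    using walk_nonneg[OF ab(1) that] by (metis S_def order.refl zero_complex.sel(1))
  let ?f = "\<lambda>h xs. Re (walk_weight h (a # xs @ [a])) * rcharpoly h (S - set xs) x"
  have "sum (?f h') (dlists S - {[]}) < sum (?f h) (dlists S - {[]})"
  proof (rule sum_strict_mono_ex1)
    have pos: "rcharpoly h (S - T) x > 0" for T using S by (intro sub) auto
    show "finite (dlists S - {[]})" using S by (simp add: finite_dlists)
    show "\<forall>xs\<in>dlists S - {[]}. ?f h' xs \<le> ?f h xs"
      using le pos S by (auto simp: same less_imp_le intro!: mult_right_mono)
    \<comment> \<open>The walk \<open>a, b, a\<close> makes the inequality strict.\<close>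
    have "?f h' [b] = 0" by (simp add: h'_def)
    also have "0 < ?f h [b]" using pos ab edge_weight[of a b] by simp
    finally show "\<exists>xs\<in>dlists S - {[]}. ?f h' xs < ?f h xs"
      using S by (intro bexI[of _ "[b]"]) (auto simp: dlists_def)
  qed
  moreover have "rcharpoly h' V x = x * rcharpoly h' S x - sum (?f h') (dlists S - {[]})"
    unfolding S(3)
  proof (rule rcharpoly_insert[OF S(1,2)])
    show "h' j i = cnj (h' i j)" for i j
      unfolding h'_def insert_commute[of j i] using hermitian[of j i] by simp
    show "h' a a = 0" using diag by (simp add: h'_def)
  qed
  moreover have "rcharpoly h V x = x * rcharpoly h S x - sum (?f h) (dlists S - {[]})"
    unfolding S(3) by (rule rcharpoly_insert[OF S(1,2) hermitian diag])
  ultimately show ?thesis using V same[OF S(2)] by simp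
qed

end

section \<open>Spectral radius of mixed graphs\<close>

text \<open>With \<open>s = -1\<close> this reflects the spectrum and exchanges negative and
  positive eigenvalues.\<close>

lemma sdet_charmat_scale:
  "sdet S (charmat (\<lambda>i j. s * h i j) (s * k)) = s ^ card S * sdet S (charmat h k)"
  unfolding sdet_scale[symmetric] by (intro sdet_cong) (simp add: charmat_def algebra_simps)

lemma sdet_charmat_eq_0_iff:
  assumes "finite S"
  shows "sdet S (charmat h k) = 0 \<longleftrightarrow>
    (\<exists>x. (\<exists>v\<in>S. x v \<noteq> 0) \<and> (\<forall>u\<in>S. (\<Sum>v\<in>S. h u v * x v) = k * x u))"
proof -
  have "(\<Sum>v\<in>S. charmat h k u v * x v) = k * x u - (\<Sum>v\<in>S. h u v * x v)" if "u \<in> S" for u x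
  proof -
    have "(\<Sum>v\<in>S. charmat h k u v * x v) =
        (\<Sum>v\<in>S. (if u = v then k * x v else 0) - h u v * x v)"
      by (intro sum.cong) (auto simp: charmat_def algebra_simps)
    then show ?thesis using assms that by (simp add: sum_subtractf)
  qed
  then show ?thesis unfolding sdet_eq_0_iff[OF assms] by (auto 4 4)
qed

text \<open>The Hermitian form \<open>Q\<close> of an eigenvector equals its own conjugate, and it
  is \<open>k\<close> times the positive squared norm \<open>N\<close>.\<close>

lemma hermitian_eigenvalue_real:
  assumes "finite S" "\<And>i j. h j i = cnj (h i j)" "sdet S (charmat h k) = 0"
  shows "k \<in> \<real>"
proof -
  obtain x where x: "\<exists>v\<in>S. x v \<noteq> 0" "\<And>u. u \<in> S \<Longrightarrow> (\<Sum>v\<in>S. h u v * x v) = k * x u"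
    using assms(3) unfolding sdet_charmat_eq_0_iff[OF assms(1)] by auto
  define N where "N = (\<Sum>u\<in>S. (cmod (x u))\<^sup>2)"
  have "N > 0"
    unfolding N_def using x(1) assms(1) by (auto intro!: sum_pos2)
  define Q where "Q = (\<Sum>u\<in>S. \<Sum>v\<in>S. cnj (x u) * (h u v * x v))"
  have "cnj Q = (\<Sum>u\<in>S. \<Sum>v\<in>S. x u * (cnj (h u v) * cnj (x v)))"
    by (simp add: Q_def)
  also have "\<dots> = (\<Sum>u\<in>S. \<Sum>v\<in>S. x u * (h v u * cnj (x v)))"
    by (simp only: assms(2)[symmetric])
  also have "\<dots> = Q"
    unfolding Q_def by (subst sum.swap) (simp add: algebra_simps)
  finally have "cnj Q = Q" .
  moreover have "Q = k * of_real N"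
  proof -
    have "Q = (\<Sum>u\<in>S. cnj (x u) * (k * x u))"
      unfolding Q_def by (intro sum.cong) (auto simp: x(2) simp flip: sum_distrib_left)
    also have "\<dots> = (\<Sum>u\<in>S. k * of_real ((cmod (x u))\<^sup>2))"
      unfolding complex_norm_square by (simp only: ac_simps)
    finally show ?thesis by (simp only: N_def of_real_sum sum_distrib_left)
  qed
  ultimately have "cnj k = k" using \<open>N > 0\<close> by simp
  then show ?thesis by (simp add: Reals_cnj_iff)
qed

lemma hermitian_entry_cnj:
  "is_mixed_graph D \<Longrightarrow> hermitian_entry D v u = cnj (hermitian_entry D u v)"
  by (auto simp: hermitian_entry_def is_mixed_graph_def insert_commute)

lemma hermitian_entry_diag: "is_mixed_graph D \<Longrightarrow> hermitian_entry D u u = 0"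
  by (auto simp: hermitian_entry_def is_mixed_graph_def)

lemma hermitian_entry_nonzero_iff: "hermitian_entry D u v \<noteq> 0 \<longleftrightarrow> {u, v} \<in> edges D"
  by (simp add: hermitian_entry_def)

lemma eigenvalue_iff_sdet:
  "distinct vs \<Longrightarrow> eigenvalue (hermitian_adjacency_list D vs) k \<longleftrightarrow>
    sdet (set vs) (charmat (hermitian_entry D) k) = 0"
  by (simp add: eigenvalue_hermitian_adjacency_list sdet_charmat_eq_0_iff)

text \<open>Nonemptiness matters: a 0 by 0 matrix has no eigenvalue.\<close>

lemma mixed_spectral_radius_attained:
  assumes "finite (verts D)" "verts D \<noteq> {}"
  obtains k where "sdet (verts D) (charmat (hermitian_entry D) k) = 0"
    "cmod k = mixed_spectral_radius D"
proof -
  obtain vs where vs: "distinct vs" "set vs = verts D"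
    using finite_distinct_list[OF assms(1)] by blast
  have "hermitian_adjacency_list D vs \<in> carrier_mat (length vs) (length vs)"
    by (simp add: hermitian_adjacency_list_def)
  from spectral_radius_mem_max(1)[OF this] show thesis
    using that vs assms(2) eigenvalue_iff_sdet[OF vs(1), of D]
    by (fastforce simp: mixed_spectral_radius_eq[OF vs] spectrum_def)
qed

lemma mixed_spectral_radius_ge:
  assumes "finite (verts D)" "verts D \<noteq> {}" "sdet (verts D) (charmat (hermitian_entry D) k) = 0"
  shows "cmod k \<le> mixed_spectral_radius D"
proof -
  obtain vs where vs: "distinct vs" "set vs = verts D"
    using finite_distinct_list[OF assms(1)] by blast
  have "hermitian_adjacency_list D vs \<in> carrier_mat (length vs) (length vs)"
    by (simp add: hermitian_adjacency_list_def)
  moreover have "length vs > 0" using vs assms(2) by auto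
  moreover have "cmod k \<in> norm ` spectrum (hermitian_adjacency_list D vs)"
    using vs assms(3) by (simp add: spectrum_def eigenvalue_iff_sdet)
  ultimately show ?thesis
    unfolding mixed_spectral_radius_eq[OF vs] by (rule spectral_radius_mem_max(2))
qed

text \<open>Both signs are needed since the spectral radius may be attained at a negative eigenvalue.\<close>

lemma mixed_spectral_radius_less:
  assumes D: "is_mixed_graph D" "verts D \<noteq> {}"
    and D': "is_mixed_graph D'" "verts D' \<noteq> {}"
    and bound: "\<And>s. s = 1 \<or> s = - 1 \<Longrightarrow>
      \<exists>x0. rcharpoly (\<lambda>i j. of_real s * hermitian_entry D i j) (verts D) x0 = 0 \<and>
        (\<forall>x\<ge>x0. rcharpoly (\<lambda>i j. of_real s * hermitian_entry D' i j) (verts D') x > 0)"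
  shows "mixed_spectral_radius D' < mixed_spectral_radius D"
proof -
  have fin: "finite (verts D)" "finite (verts D')" using D D' by (auto simp: is_mixed_graph_def)
  obtain k where k: "sdet (verts D') (charmat (hermitian_entry D') k) = 0"
      "cmod k = mixed_spectral_radius D'"
    using mixed_spectral_radius_attained[OF fin(2) D'(2)] .
  have "k \<in> \<real>" using hermitian_eigenvalue_real[OF fin(2) hermitian_entry_cnj[OF D'(1)] k(1)] .
  then obtain r where r: "k = of_real r" by (auto elim: Reals_cases)
  \<comment> \<open>\<open>s\<close> is the sign of the extremal eigenvalue \<open>r\<close> of
    \<open>D'\<close>, so \<open>s * r = \<bar>r\<bar>\<close> is an eigenvalue for the scaled
    entries.\<close>
  define s :: real where "s = (if r \<ge> 0 then 1 else - 1)"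
  have s: "s = 1 \<or> s = - 1" and abs: "\<bar>r\<bar> = s * r" and ss: "s * s = 1" by (auto simp: s_def)
  obtain x0 where x0:
    "rcharpoly (\<lambda>i j. of_real s * hermitian_entry D i j) (verts D) x0 = 0"
    "\<And>x. x \<ge> x0 \<Longrightarrow> rcharpoly (\<lambda>i j. of_real s * hermitian_entry D' i j) (verts D') x > 0"
    using bound[OF s] by blast
  have "rcharpoly (\<lambda>i j. of_real s * hermitian_entry D' i j) (verts D') \<bar>r\<bar> = 0"
    using k(1) sdet_charmat_scale[of "verts D'" "of_real s" "hermitian_entry D'" k]
    by (simp add: rcharpoly_def abs r)
  then have "\<bar>r\<bar> < x0" using x0(2)[of "\<bar>r\<bar>"] by force
  \<comment> \<open>Since \<open>s * s = 1\<close>, the zero \<open>x0\<close> for the scaled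
    entries gives the eigenvalue \<open>s * x0\<close> of \<open>D\<close> itself.\<close>
  moreover have "sdet (verts D) (charmat (hermitian_entry D) (of_real (s * x0))) = 0"
  proof -
    let ?h = "\<lambda>i j. of_real s * hermitian_entry D i j"
    have "of_real s ^ card (verts D) * sdet (verts D) (charmat (hermitian_entry D) (of_real (s * x0))) =
        sdet (verts D) (charmat ?h (of_real (s * (s * x0))))"
      unfolding of_real_mult[of s "s * x0"] by (rule sdet_charmat_scale[symmetric])
    also have "s * (s * x0) = x0" using ss by (simp flip: mult.assoc)
    also have "sdet (verts D) (charmat ?h (of_real x0)) = of_real (rcharpoly ?h (verts D) x0)"
      unfolding rcharpoly_def
      using hermitian_entry_cnj[OF D(1)]
      by (intro sdet_charmat_real fin) (metis complex_cnj_complex_of_real complex_cnj_mult)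
    finally show ?thesis using x0(1) s by auto
  qed
  from mixed_spectral_radius_ge[OF fin(1) D(2) this] have "\<bar>s * x0\<bar> \<le> mixed_spectral_radius D"
    by (simp del: of_real_mult)
  moreover have "\<bar>s * x0\<bar> = \<bar>x0\<bar>" using s by auto
  moreover have "cmod k = \<bar>r\<bar>" by (simp add: r)
  ultimately show ?thesis using k(2) by linarith
qed

section \<open>Values of mixed cycles\<close>

lemma prod_fourth_roots_of_unity:
  fixes f :: "nat \<Rightarrow> complex"
  assumes "\<And>i. i < n \<Longrightarrow> f i \<in> {1, - 1, \<i>, - \<i>}"
  shows "(\<Prod>i<n. f i) \<in> {1, - 1, \<i>, - \<i>}"
  using assms
proof (induction n)
  case (Suc n)
  then have "(\<Prod>i<n. f i) \<in> {1, - 1, \<i>, - \<i>}" "f n \<in> {1, - 1, \<i>, - \<i>}" by simp_all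
  then show ?case by auto
qed simp

lemma walk_weight_closed:
  assumes "xs \<noteq> []"
  shows "walk_weight (hermitian_entry D) (xs @ [hd xs]) = cycle_value D xs"
  unfolding walk_weight_def cycle_value_def
proof (intro prod.cong)
  fix i assume "i \<in> {..<length xs}"
  \<comment> \<open>At the last index \<open>Suc i mod length xs\<close> wraps to 0, matching the
    appended head.\<close>
  then have "Suc i < length xs \<or> Suc i = length xs" "i < length xs" by auto
  then show "hermitian_entry D ((xs @ [hd xs]) ! i) ((xs @ [hd xs]) ! Suc i) =
      hermitian_entry D (xs ! i) (xs ! (Suc i mod length xs))"
    using assms by (auto simp: nth_append hd_conv_nth)
qed simp

lemma walk_weight_scale:
  "walk_weight (\<lambda>i j. s * h i j) xs = s ^ (length xs - 1) * walk_weight h xs"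
  by (simp add: walk_weight_def prod.distrib)

text \<open>Values of mixed cycles are fourth roots of unity: a non-real one is purely imaginary,
  and a real one is 1 on an even cycle by hypothesis. The odd case serves the sign change to
  \<open>- h\<close>.\<close>

lemma cycle_value_Re:
  assumes real: "\<And>C. real_cycle D C \<Longrightarrow> positive_cycle D C \<and> even (length C)"
    and xs: "distinct xs" "length xs \<ge> 3"
  shows "Re (cycle_value D xs) \<ge> 0" "odd (length xs) \<Longrightarrow> Re (cycle_value D xs) = 0"
proof -
  have "Re (cycle_value D xs) = 0 \<or> cycle_value D xs = 1 \<and> even (length xs)"
  proof (cases "mixed_cycle D xs")
    case True
    have "cycle_value D xs \<in> {1, - 1, \<i>, - \<i>}"
      unfolding cycle_value_def
      by (rule prod_fourth_roots_of_unity)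
        (use True in \<open>simp add: mixed_cycle_def hermitian_entry_def\<close>)
    then show ?thesis
      using real[of xs] True by (auto simp: real_cycle_def positive_cycle_def)
  next
    \<comment> \<open>Some consecutive pair is not an edge, and its entry 0 makes the product
      vanish.\<close>
    case False
    then obtain i where "i < length xs" "{xs ! i, xs ! (Suc i mod length xs)} \<notin> edges D"
      using xs by (auto simp: mixed_cycle_def)
    then have "cycle_value D xs = 0"
      unfolding cycle_value_def by (intro prod_zero) (auto simp: hermitian_entry_def)
    then show ?thesis by simp
  qed
  then show "Re (cycle_value D xs) \<ge> 0" "odd (length xs) \<Longrightarrow> Re (cycle_value D xs) = 0" by auto
qed

text \<open>Without an edge across the boundary, a walk starting outside \<open>C\<close> stays
  outside and never reaches \<open>C\<close>.\<close>

lemma connected_mixed_graph_boundary: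
  assumes "is_mixed_graph D" "connected_mixed_graph D" "C \<subset> verts D" "C \<noteq> {}"
  shows "\<exists>u\<in>verts D - C. \<exists>v\<in>C. {u, v} \<in> edges D"
proof (rule ccontr)
  assume none: "\<not> ?thesis"
  obtain c d where cd: "c \<in> C" "d \<in> verts D - C" using assms(3,4) by blast
  then have "(d, c) \<in> {(x, y). {x, y} \<in> edges D}\<^sup>*"
    using assms(2,3) by (auto simp: connected_mixed_graph_def)
  then have "c \<in> verts D - C"
  proof (induction rule: rtrancl_induct)
    case (step y z)
    then have "z \<in> verts D" using assms(1) by (auto simp: is_mixed_graph_def)
    with step none show ?case by auto
  qed (use cd in simp)
  with cd show False by blast
qed

text \<open>For \<open>s = -1\<close> a cycle weight changes by the parity of the length: even
  cycles keep their value, and odd ones have real part 0.\<close>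

lemma nonneg_cycle_gain_hermitian_entry:
  assumes D: "is_mixed_graph D" "connected_mixed_graph D"
    and real: "\<And>C. real_cycle D C \<Longrightarrow> positive_cycle D C \<and> even (length C)"
    and s: "s = 1 \<or> s = - 1"
  shows "nonneg_cycle_gain (verts D) (\<lambda>u v. of_real s * hermitian_entry D u v)"
proof
  show "finite (verts D)" "verts D \<noteq> {}"
    using D by (auto simp: is_mixed_graph_def connected_mixed_graph_def)
  show "of_real s * hermitian_entry D j i = cnj (of_real s * hermitian_entry D i j)" for i j
    using hermitian_entry_cnj[OF D(1), of j i] by simp
  show "of_real s * hermitian_entry D i i = 0" for i
    using hermitian_entry_diag[OF D(1)] by simp
  show "Re (walk_weight (\<lambda>u v. of_real s * hermitian_entry D u v) (xs @ [hd xs])) \<ge> 0"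
    if "distinct xs" "set xs \<subseteq> verts D" "length xs \<ge> 3" for xs
  proof -
    have "xs \<noteq> []" using that by auto
    then have "walk_weight (\<lambda>u v. of_real s * hermitian_entry D u v) (xs @ [hd xs]) =
        of_real (s ^ length xs) * cycle_value D xs"
      by (simp add: walk_weight_scale walk_weight_closed)
    then show ?thesis
      using cycle_value_Re[OF real that(1,3)] s
      by (cases "even (length xs)") (auto simp del: of_real_power)
  qed
  show "\<exists>u\<in>verts D - C. \<exists>v\<in>C. of_real s * hermitian_entry D u v \<noteq> 0"
    if "C \<subset> verts D" "C \<noteq> {}" for C
    using connected_mixed_graph_boundary[OF D that] s by (auto simp: hermitian_entry_nonzero_iff)
qed

section \<open>Deleting vertices and edges\<close>

lemma hermitian_entry_delete_vertex:
  "x \<noteq> u \<Longrightarrow> y \<noteq> u \<Longrightarrow> hermitian_entry (delete_vertex D u) x y = hermitian_entry D x y"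
  by (simp add: hermitian_entry_def delete_vertex_def)

lemma hermitian_entry_delete_edge:
  "hermitian_entry (delete_edge D e) x y = (if {x, y} = e then 0 else hermitian_entry D x y)"
  by (auto simp: hermitian_entry_def delete_edge_def insert_commute)

text \<open>The guard on \<open>delete_vertex\<close> excludes the one-vertex graph, whose deletion
  leaves an empty spectrum without a maximum.\<close>

theorem theorem3p1:
  fixes D :: "'a mixed_graph"
  assumes "is_mixed_graph D"
    and "connected_mixed_graph D"
    and "\<And>C. real_cycle D C \<Longrightarrow> positive_cycle D C \<and> even (length C)"
  shows "(\<forall>u\<in>verts D. verts (delete_vertex D u) \<noteq> {} \<longrightarrow>
            mixed_spectral_radius D > mixed_spectral_radius (delete_vertex D u)) \<and>
         (\<forall>e\<in>edges D. mixed_spectral_radius D > mixed_spectral_radius (delete_edge D e))"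
proof (intro conjI ballI impI)
  have V: "verts D \<noteq> {}" using assms(2) by (simp add: connected_mixed_graph_def)
  fix u assume u: "u \<in> verts D" "verts (delete_vertex D u) \<noteq> {}"
  have V': "verts (delete_vertex D u) = verts D - {u}" by (simp add: delete_vertex_def)
  show "mixed_spectral_radius D > mixed_spectral_radius (delete_vertex D u)"
  proof (rule mixed_spectral_radius_less[OF assms(1) V is_mixed_graph_delete_vertex[OF assms(1)] u(2)])
    fix s :: real assume s: "s = 1 \<or> s = - 1"
    interpret nonneg_cycle_gain "verts D" "\<lambda>i j. of_real s * hermitian_entry D i j"
      by (intro nonneg_cycle_gain_hermitian_entry assms s)
    \<comment> \<open>Entries away from \<open>u\<close> are untouched, so the smaller graph has the
      polynomial of a proper subset, positive from the largest zero on.\<close>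
    have "rcharpoly (\<lambda>i j. of_real s * hermitian_entry (delete_vertex D u) i j)
        (verts (delete_vertex D u)) =
        rcharpoly (\<lambda>i j. of_real s * hermitian_entry D i j) (verts D - {u})"
      unfolding rcharpoly_def V'
      by (intro ext arg_cong[where f = Re] sdet_cong)
        (auto simp: charmat_def hermitian_entry_delete_vertex)
    moreover have "verts D - {u} \<subset> verts D" using u by blast
    ultimately show "\<exists>x0. rcharpoly (\<lambda>i j. of_real s * hermitian_entry D i j) (verts D) x0 = 0 \<and>
        (\<forall>x\<ge>x0. rcharpoly (\<lambda>i j. of_real s * hermitian_entry (delete_vertex D u) i j)
          (verts (delete_vertex D u)) x > 0)"
      using largest_zero by metis
  qed
next
  have V: "verts D \<noteq> {}" using assms(2) by (simp add: connected_mixed_graph_def)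
  fix e assume e: "e \<in> edges D"
  then have "card e = 2" "e \<subseteq> verts D" using assms(1) by (auto simp: is_mixed_graph_def)
  then obtain a b where ab: "e = {a, b}" "a \<in> verts D" "b \<in> verts D"
    by (auto simp: card_2_iff)
  have V': "verts (delete_edge D e) = verts D" by (simp add: delete_edge_def)
  show "mixed_spectral_radius D > mixed_spectral_radius (delete_edge D e)"
  proof (rule mixed_spectral_radius_less[OF assms(1) V is_mixed_graph_delete_edge[OF assms(1)]])
    show "verts (delete_edge D e) \<noteq> {}" using V V' by simp
    fix s :: real assume s: "s = 1 \<or> s = - 1"
    interpret nonneg_cycle_gain "verts D" "\<lambda>i j. of_real s * hermitian_entry D i j"
      by (intro nonneg_cycle_gain_hermitian_entry assms s)
    have nz: "of_real s * hermitian_entry D a b \<noteq> 0"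
      using e s ab by (auto simp: hermitian_entry_nonzero_iff)
    \<comment> \<open>This is the shape of \<open>h'\<close> in
      \<open>rcharpoly_remove_edge_pos\<close>.\<close>
    have h': "(\<lambda>i j. of_real s * hermitian_entry (delete_edge D e) i j) =
        (\<lambda>i j. if {i, j} = {a, b} then 0 else of_real s * hermitian_entry D i j)"
      by (auto simp: fun_eq_iff hermitian_entry_delete_edge ab(1))
    obtain x0 where x0: "rcharpoly (\<lambda>i j. of_real s * hermitian_entry D i j) (verts D) x0 = 0"
      "\<And>x. x \<ge> x0 \<Longrightarrow> rcharpoly (\<lambda>i j. of_real s * hermitian_entry D i j) (verts D) x \<ge> 0"
      "\<And>T x. T \<subset> verts D \<Longrightarrow> x \<ge> x0 \<Longrightarrow>
        rcharpoly (\<lambda>i j. of_real s * hermitian_entry D i j) T x > 0"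
      using largest_zero by blast
    have "rcharpoly (\<lambda>i j. of_real s * hermitian_entry (delete_edge D e) i j) (verts D) x > 0"
      if "x \<ge> x0" for x
      unfolding h' using that by (intro rcharpoly_remove_edge_pos ab nz x0)
    with x0(1) show "\<exists>x0. rcharpoly (\<lambda>i j. of_real s * hermitian_entry D i j) (verts D) x0 = 0 \<and>
        (\<forall>x\<ge>x0. rcharpoly (\<lambda>i j. of_real s * hermitian_entry (delete_edge D e) i j)
          (verts (delete_edge D e)) x > 0)"
      unfolding V' by blast
  qed
qed

end
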